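(* Let $p,\ell\in\mathbb{N}$ with $p\ge 2$. For any integer $m\ge 4\ell+2$ and any sequence $\{A_n\}_{n\in\mathbb{Z}_+}$ of subsets of $\Lambda_p^m$ with $|A_n|\le\ell$ for each $n\in\mathbb{Z}_+$, there exists $x\in\Sigma_p$ such that $x[n,n+m-1]\notin A_n$ for every $n\in\mathbb{Z}_+$.
   Context: $\mathbb{Z}_+=\{0,1,2,\dots\}$, $\mathbb{N}=\{1,2,\dots\}$. $\Lambda_p=\{0,1,\dots,p-1\}$, $\Lambda_p^m$ is the set of words of length $m$ over $\Lambda_p$, and $\Sigma_p=\Lambda_p^{\mathbb{Z}_+}$. For $x\in\Sigma_p$ and integers $0\le s\le t$, $x[s,t]$ denotes the word $(x(s),x(s+1),\dots,x(t))$ of length $t-s+1$. *)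

theory Defs
  imports Main
begin

definition alphabet :: "nat \<Rightarrow> nat set" where
  "alphabet p = {0..<p}"

definition words :: "nat \<Rightarrow> nat \<Rightarrow> nat list set" where
  "words p m = {w. length w = m \<and> set w \<subseteq> alphabet p}"

definition full_shift :: "nat \<Rightarrow> (nat \<Rightarrow> nat) set" where
  "full_shift p = {x. \<forall>i. x i \<in> alphabet p}"

(* The word x[s,t] = (x(s), x(s+1), ..., x(t)), both ends included; used for s \<le> t. *)
definition factor :: "(nat \<Rightarrow> nat) \<Rightarrow> nat \<Rightarrow> nat \<Rightarrow> nat list" where
  "factor x s t = map x [s..<Suc t]"

end

theory Submission
  imports Defs Complex_Main "HOL-Library.Sublist"
begin

text \<open>
  The sequence can be built greedily over two letters, by an averaging argument that derandomises
  a first-moment estimate. A forbidden word \<open>a \<in> A k\<close> threatens a finite prefix \<open>w\<close> if the part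
  of \<open>w\<close> from position \<open>k\<close> on is a prefix of \<open>a\<close>. Give such a threat the weight \<open>c ^ j\<close>, where \<open>j\<close>
  is the number of letters already matched and \<open>1 < c < 2\<close> is a constant, and let the danger of \<open>w\<close>
  be the total weight. A new letter can continue each threat in one way only, so for two candidate
  letters the average weight of the old threats changes by a factor of at most \<open>c / 2\<close>; at most \<open>l\<close>
  fresh threats of weight \<open>1\<close> are added. The better letter therefore sends a danger of at most \<open>B\<close>
  to one of at most \<open>c / 2 * B + l\<close>, and \<open>B = 2 * l / (2 - c)\<close> is a fixed point of this map: a danger
  of at most \<open>B\<close> can be maintained for ever. A completed forbidden word alone contributes \<open>c ^ m\<close>,
  so none occurs once \<open>c ^ m > B\<close>. For \<open>c = 3/2\<close> the bound is \<open>B = 4 * l\<close>, and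
  \<open>(3/2) ^ m\<close> exceeds it for \<open>m \<ge> 4 * l\<close> by Bernoulli's inequality.
\<close>

definition danger :: "(nat \<Rightarrow> 'a list set) \<Rightarrow> real \<Rightarrow> 'a list \<Rightarrow> real" where
  "danger A c w =
     (\<Sum>k\<le>length w. real (card {a \<in> A k. prefix (drop k w) a}) * c ^ (length w - k))"

text \<open>The two letters split the words that extend \<open>v\<close>: no word extends both continuations.\<close>

lemma card_prefix_snoc_add_le:
  assumes "finite S" and "b \<noteq> b'"
  shows "card {a \<in> S. prefix (v @ [b]) a} + card {a \<in> S. prefix (v @ [b']) a}
         \<le> card {a \<in> S. prefix v a}"
proof -
  let ?X = "{a \<in> S. prefix (v @ [b]) a}" and ?Y = "{a \<in> S. prefix (v @ [b']) a}"
  have "?X \<inter> ?Y = {}"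
    using assms(2) by (auto simp: prefix_def)
  then have "card ?X + card ?Y = card (?X \<union> ?Y)"
    using assms(1) by (intro card_Un_disjoint[symmetric]) auto
  also have "\<dots> \<le> card {a \<in> S. prefix v a}"
    using assms(1) by (intro card_mono) (auto simp: prefix_def)
  finally show ?thesis .
qed

text \<open>The new index \<open>k = length w + 1\<close> contributes all of its forbidden words with weight \<open>1\<close>,
  since nothing of them has been matched yet.\<close>

lemma danger_snoc:
  "danger A c (w @ [b]) =
     c * (\<Sum>k\<le>length w. real (card {a \<in> A k. prefix (drop k w @ [b]) a}) * c ^ (length w - k))
     + real (card (A (Suc (length w))))"
proof -
  have "(\<Sum>k\<le>length w. real (card {a \<in> A k. prefix (drop k (w @ [b])) a}) * c ^ (Suc (length w) - k))
      = c * (\<Sum>k\<le>length w. real (card {a \<in> A k. prefix (drop k w @ [b]) a}) * c ^ (length w - k))"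
    unfolding sum_distrib_left by (intro sum.cong) (auto simp: Suc_diff_le)
  then show ?thesis
    by (simp add: danger_def)
qed

lemma danger_snoc_add_le:
  assumes fin: "\<And>n. finite (A n)" and card: "\<And>n. card (A n) \<le> l"
    and "b \<noteq> b'" and "c \<ge> 0"
  shows "danger A c (w @ [b]) + danger A c (w @ [b']) \<le> c * danger A c w + 2 * real l"
proof -
  let ?N = "\<lambda>k v. real (card {a \<in> A k. prefix v a})"
  let ?S = "\<lambda>d. \<Sum>k\<le>length w. ?N k (drop k w @ [d]) * c ^ (length w - k)"
  have "?S b + ?S b' =
      (\<Sum>k\<le>length w. (?N k (drop k w @ [b]) + ?N k (drop k w @ [b'])) * c ^ (length w - k))"
    by (simp add: sum.distrib distrib_right)
  also have "\<dots> \<le> danger A c w"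
    unfolding danger_def
  proof (intro sum_mono mult_right_mono)
    fix k
    show "?N k (drop k w @ [b]) + ?N k (drop k w @ [b']) \<le> ?N k (drop k w)"
      using card_prefix_snoc_add_le[OF fin \<open>b \<noteq> b'\<close>, of k "drop k w"] by linarith
  qed (use \<open>c \<ge> 0\<close> in simp)
  finally have "c * (?S b + ?S b') \<le> c * danger A c w"
    using \<open>c \<ge> 0\<close> by (rule mult_left_mono)
  then show ?thesis
    using card[of "Suc (length w)"] by (simp add: danger_snoc algebra_simps)
qed

text \<open>With \<open>B = 2 * l / (2 - c)\<close> one has \<open>c * B + 2 * l = 2 * B\<close>, so if both letters exceeded \<open>B\<close>
  their sum would violate the bound on the two dangers.\<close>

lemma exists_letter_keeping_danger:
  assumes fin: "\<And>n. finite (A n)" and card: "\<And>n. card (A n) \<le> l"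
    and "b \<noteq> b'" and "0 \<le> c" and "c < 2"
    and bound: "danger A c w \<le> 2 * real l / (2 - c)"
  shows "\<exists>d \<in> {b, b'}. danger A c (w @ [d]) \<le> 2 * real l / (2 - c)"
proof -
  define B where "B = 2 * real l / (2 - c)"
  have B: "c * B + 2 * real l = 2 * B"
    using \<open>c < 2\<close> by (simp add: B_def field_simps)
  have "c * danger A c w \<le> c * B"
    using bound \<open>0 \<le> c\<close> unfolding B_def by (rule mult_left_mono)
  then have "danger A c (w @ [b]) + danger A c (w @ [b']) \<le> 2 * B"
    using danger_snoc_add_le[where A = A and w = w, OF fin card \<open>b \<noteq> b'\<close> \<open>0 \<le> c\<close>] B by linarith
  then show ?thesis
    unfolding B_def[symmetric] by fastforce
qed

lemma occurrence_le_danger: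
  assumes fin: "\<And>n. finite (A n)" and "0 \<le> c"
    and "n \<le> length w" and "drop n w \<in> A n"
  shows "c ^ (length w - n) \<le> danger A c w"
proof -
  have "{a \<in> A n. prefix (drop n w) a} \<noteq> {}"
    using \<open>drop n w \<in> A n\<close> by auto
  then have "1 \<le> card {a \<in> A n. prefix (drop n w) a}"
    using fin[of n] by (simp add: Suc_le_eq card_gt_0_iff)
  then have "1 * c ^ (length w - n)
      \<le> real (card {a \<in> A n. prefix (drop n w) a}) * c ^ (length w - n)"
    using \<open>0 \<le> c\<close> by (intro mult_right_mono) auto
  also have "\<dots> \<le> danger A c w"
    unfolding danger_def using \<open>n \<le> length w\<close> \<open>0 \<le> c\<close>
    by (intro member_le_sum[where f = "\<lambda>k. real (card {a \<in> A k. prefix (drop k w) a})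
          * c ^ (length w - k)"]) auto
  finally show ?thesis
    by simp
qed

lemma exists_sequence_bounded_danger:
  assumes fin: "\<And>n. finite (A n)" and card: "\<And>n. card (A n) \<le> l"
    and "b \<noteq> b'" and "0 \<le> c" and "c < 2"
  shows "\<exists>x. (\<forall>n. x n \<in> {b, b'}) \<and> (\<forall>n. danger A c (map x [0..<n]) \<le> 2 * real l / (2 - c))"
proof -
  define B where "B = 2 * real l / (2 - c)"
  define good where "good = (\<lambda>x n d. d \<in> {b, b'} \<and>
    (danger A c (map x [0..<n]) \<le> B \<longrightarrow> danger A c (map x [0..<n] @ [d]) \<le> B))"
  have "\<exists>x. \<forall>n. good x n (x n)"
  proof (rule dependent_wellorder_choice)
    fix d :: 'a and f g :: "nat \<Rightarrow> 'a" and n :: nat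
    assume "\<And>i. i < n \<Longrightarrow> f i = g i"
    then have "map f [0..<n] = map g [0..<n]"
      by simp
    then show "good f n d = good g n d"
      by (simp only: good_def)
  next
    fix n :: nat and f :: "nat \<Rightarrow> 'a"
    show "\<exists>d. good f n d"
      using exists_letter_keeping_danger[where A = A and w = "map f [0..<n]",
          OF fin card \<open>b \<noteq> b'\<close> \<open>0 \<le> c\<close> \<open>c < 2\<close>]
      unfolding good_def B_def by blast
  qed
  then obtain x where x: "\<And>n. good x n (x n)"
    by blast
  have "danger A c (map x [0..<n]) \<le> B" for n
  proof (induction n)
    case 0
    \<comment> \<open>Every word of \<open>A 0\<close> threatens the empty prefix with weight \<open>1\<close>, and \<open>l \<le> B\<close> as \<open>2 - c \<le> 2\<close>.\<close>
    have "real l * (2 - c) \<le> real l * 2"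
      using \<open>0 \<le> c\<close> by (intro mult_left_mono) auto
    then have "real l \<le> B"
      using \<open>c < 2\<close> by (simp add: B_def pos_le_divide_eq mult.commute)
    then show ?case
      using card[of 0] by (simp add: danger_def)
  next
    case (Suc n)
    then show ?case
      using x[of n] by (simp add: good_def)
  qed
  then show ?thesis
    using x unfolding good_def B_def by blast
qed

theorem exists_avoiding_sequence:
  assumes fin: "\<And>n. finite (A n)" and card: "\<And>n. card (A n) \<le> l"
    and "b \<noteq> b'" and "0 \<le> c" and "c < 2"
    and large: "2 * real l / (2 - c) < c ^ m"
  shows "\<exists>x. (\<forall>n. x n \<in> {b, b'}) \<and> (\<forall>n. map x [n..<n + m] \<notin> A n)"
proof -
  obtain x where x: "\<And>n. x n \<in> {b, b'}"
    and bound: "\<And>n. danger A c (map x [0..<n]) \<le> 2 * real l / (2 - c)"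
    using exists_sequence_bounded_danger[where A = A, OF fin card \<open>b \<noteq> b'\<close> \<open>0 \<le> c\<close> \<open>c < 2\<close>]
    by blast
  have "map x [n..<n + m] \<notin> A n" for n
  proof
    assume "map x [n..<n + m] \<in> A n"
    then have "drop n (map x [0..<n + m]) \<in> A n"
      by (simp add: drop_map)
    from occurrence_le_danger[where A = A, OF fin \<open>0 \<le> c\<close> _ this]
    have "c ^ m \<le> danger A c (map x [0..<n + m])"
      by simp
    then show False
      using bound[of "n + m"] large by linarith
  qed
  then show ?thesis
    using x by blast
qed

lemma four_times_less_power:
  assumes "m \<ge> 4 * l"
  shows "4 * real l < (3/2) ^ m"
proof -
  \<comment> \<open>The base is \<open>1 + 65/16 = (3/2) ^ 4\<close>.\<close>
  have "1 + real l * (65/16) \<le> (1 + 65/16 :: real) ^ l"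
    by (rule Bernoulli_inequality) simp
  also have "\<dots> = (3/2) ^ (4 * l)"
    by (simp add: power_mult power_divide)
  also have "\<dots> \<le> (3/2) ^ m"
    using assms by (intro power_increasing) auto
  finally show ?thesis
    by simp
qed

lemma finite_words: "finite (words p m)"
proof -
  have "words p m = {w. set w \<subseteq> alphabet p \<and> length w = m}"
    by (auto simp: words_def)
  then show ?thesis
    using finite_lists_length_eq[of "alphabet p" m] by (simp add: alphabet_def)
qed

theorem theorem5p12:
  fixes p l m :: nat and A :: "nat \<Rightarrow> nat list set"
  assumes "p \<ge> 2" and "l \<ge> 1" and "m \<ge> 4 * l + 2"
    and "\<And>n. A n \<subseteq> words p m"
    and "\<And>n. card (A n) \<le> l"
  shows "\<exists>x \<in> full_shift p. \<forall>n. factor x n (n + m - 1) \<notin> A n"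
proof -
  have fin: "finite (A n)" for n
    using assms(4) finite_words by (rule finite_subset)
  have large: "2 * real l / (2 - 3/2) < (3/2) ^ m"
    using four_times_less_power[of l m] assms(3) by simp
  obtain x :: "nat \<Rightarrow> nat" where x: "\<And>n. x n \<in> {0, 1}" and avoid: "\<And>n. map x [n..<n + m] \<notin> A n"
    using exists_avoiding_sequence[where A = A, OF fin assms(5) zero_neq_one _ _ large] by auto
  have "x n < p" for n
    using x[of n] assms(1) by auto
  then have "x \<in> full_shift p"
    by (simp add: full_shift_def alphabet_def)
  moreover have "factor x n (n + m - 1) = map x [n..<n + m]" for n
    using assms(3) by (simp add: factor_def)
  ultimately show ?thesis
    using avoid by metis
qed

end
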